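(* (Galilean invariance of the $N$-phase six-equation model with Phase-Field mechanism.) Let $N,d\ge1$, and let $\alpha_p,\rho_p,e_p,P_p$ (scalar), $\mathbf u,\mathbf J_p,\mathbf Q_p$ ($\mathbb R^d$-valued), $\boldsymbol\sigma_p$ ($d\times d$-matrix-valued), $\zeta^I_{p,q},P^I_{p,q},Q^I_{p\leftarrow q}$ (scalar), $1\le p,q\le N$, be smooth functions of $(\mathbf x,t)\in\mathbb R^d\times\mathbb R$ with $\rho:=\sum_q\alpha_q\rho_q>0$. Put $E_p=e_p+\tfrac12\mathbf u\cdot\mathbf u$ and $$\mathbf F^I_{p\leftarrow q}=\frac{\alpha_p\rho_p}{\rho}\nabla\cdot(\alpha_q\boldsymbol\sigma_q)-\frac{\alpha_q\rho_q}{\rho}\nabla\cdot(\alpha_p\boldsymbol\sigma_p)+\frac{\alpha_p\rho_p}{\rho}(\rho_q\mathbf J_q)\cdot\nabla\mathbf u-\frac{\alpha_q\rho_q}{\rho}(\rho_p\mathbf J_p)\cdot\nabla\mathbf u .$$ Suppose these fields satisfy, for all $1\le p\le N$, $$\frac{\partial(\alpha_p\rho_p)}{\partial t}+\nabla\cdot\big((\alpha_p\mathbf u-\mathbf J_p)\rho_p\big)=0,$$ $$\frac{\partial(\rho\mathbf u)}{\partial t}+\nabla\cdot\Big(\sum_{q}(\alpha_q\mathbf u-\mathbf J_q)\rho_q\otimes\mathbf u\Big)=\nabla\cdot\Big(\sum_q\alpha_q\boldsymbol\sigma_q\Big),$$ $$\frac{\partial(\alpha_p\rho_pE_p)}{\partial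 t}+\nabla\cdot\big((\alpha_p\mathbf u-\mathbf J_p)\rho_pE_p\big)=\nabla\cdot(\alpha_p\mathbf u\cdot\boldsymbol\sigma_p)-\nabla\cdot(\alpha_p\mathbf Q_p)+\sum_q\mathbf u\cdot\mathbf F^I_{p\leftarrow q}-\sum_q\zeta^I_{p,q}P^I_{p,q}(P_p-P_q)+\sum_qQ^I_{p\leftarrow q},$$ $$\frac{\partial\alpha_p}{\partial t}+\nabla\cdot(\alpha_p\mathbf u-\mathbf J_p)=\alpha_p\nabla\cdot\mathbf u+\sum_q\zeta^I_{p,q}(P_p-P_q).$$ Let $\mathbf u_0\in\mathbb R^d$ be constant and define the fields in the moving frame by $\mathbf u'(\mathbf x',t')=\mathbf u(\mathbf x'+\mathbf u_0t',t')-\mathbf u_0$ and $f'(\mathbf x',t')=f(\mathbf x'+\mathbf u_0t',t')$ for every other field $f\in\{\alpha_p,\rho_p,e_p,P_p,\mathbf J_p,\mathbf Q_p,\boldsymbol\sigma_p,\zeta^I_{p,q},P^I_{p,q},Q^I_{p\leftarrow q}\}$, with $\rho'=\sum_q\alpha'_q\rho'_q$, $E'_p=e'_p+\tfrac12\mathbf u'\cdot\mathbf u'$, and $(\mathbf F^I_{p\leftarrow q})'$ given by the same formula as $\mathbf F^I_{p\leftarrow q}$ with primed fields and derivatives in $\mathbf x'$. Then the primed fields satisfy the same four families of equations with respect to $(\mathbf x',t')$.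
   Context: Conventions in components: for vector fields $\mathbf a,\mathbf b$, $[\nabla\cdot(\mathbf a\otimes\mathbf b)]_j=\sum_i\partial_i(a_ib_j)$ and $[\mathbf a\cdot\nabla\mathbf u]_j=\sum_ia_i\partial_iu_j$; for a matrix field, $[\nabla\cdot\boldsymbol\sigma]_j=\sum_i\partial_i\sigma_{ij}$ and $[\mathbf u\cdot\boldsymbol\sigma]_i=\sum_j\sigma_{ij}u_j$. Sums over $q$ run from $1$ to $N$. Here $\alpha_p,\rho_p,e_p,P_p$ are the volume fraction, density, specific internal energy and pressure of phase $p$; $\mathbf u$ the common velocity; $\mathbf J_p$ the Phase-Field flux; $\boldsymbol\sigma_p$ the phasic stress; $\mathbf Q_p$ the heat flux; $Q^I_{p\leftarrow q}$ the interfacial heat transfer; $\zeta^I_{p,q}$ and $P^I_{p,q}$ the pressure relaxation coefficient and interfacial pressure. The assumption that $\mathbf J_p,\boldsymbol\sigma_p,\mathbf Q_p,Q^I_{p\leftarrow q}$ are objective (frame indifferent) is encoded in $f'(\mathbf x',t')=f(\mathbf x'+\mathbf u_0t',t')$. *)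

theory Defs
  imports "HOL-Analysis.Analysis"
begin

type_synonym ('d, 'b) field = "(real ^ 'd) \<times> real \<Rightarrow> 'b"

primrec C_k :: "nat \<Rightarrow> ('a::euclidean_space \<Rightarrow> 'b::real_normed_vector) \<Rightarrow> bool" where
  "C_k 0 f \<longleftrightarrow> continuous_on UNIV f"
| "C_k (Suc k) f \<longleftrightarrow> (\<forall>x. f differentiable (at x)) \<and> (\<forall>v. C_k k (\<lambda>x. frechet_derivative f (at x) v))"

definition smooth :: "('a::euclidean_space \<Rightarrow> 'b::real_normed_vector) \<Rightarrow> bool" where
  "smooth f \<longleftrightarrow> (\<forall>k. C_k k f)"

definition time_deriv :: "('d::finite, 'b::real_normed_vector) field \<Rightarrow> ('d, 'b) field" where
  "time_deriv f = (\<lambda>(x, t). vector_derivative (\<lambda>s. f (x, s)) (at t))"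

definition space_deriv :: "'d::finite \<Rightarrow> ('d, 'b::real_normed_vector) field \<Rightarrow> ('d, 'b) field" where
  "space_deriv i f = (\<lambda>(x, t). vector_derivative (\<lambda>s. f (x + s *\<^sub>R axis i 1, t)) (at 0))"

definition divergence :: "('d::finite, real ^ 'd) field \<Rightarrow> ('d, real) field" where
  "divergence a = (\<lambda>z. \<Sum>i\<in>UNIV. space_deriv i (\<lambda>y. a y $ i) z)"

text \<open>The matrix entry \<open>S\<^sub>i\<^sub>j\<close> is \<open>S $ i $ j\<close>; the divergence contracts the first (row) index.\<close>

definition tensor_divergence :: "('d::finite, real ^ 'd ^ 'd) field \<Rightarrow> ('d, real ^ 'd) field" where
  "tensor_divergence S = (\<lambda>z. \<chi> j. \<Sum>i\<in>UNIV. space_deriv i (\<lambda>y. S y $ i $ j) z)"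

definition outer :: "real ^ 'd::finite \<Rightarrow> real ^ 'd \<Rightarrow> real ^ 'd ^ 'd" where
  "outer a b = (\<chi> i j. a $ i * b $ j)"

definition advect :: "('d::finite, real ^ 'd) field \<Rightarrow> ('d, real ^ 'd) field \<Rightarrow> ('d, real ^ 'd) field" where
  "advect a v = (\<lambda>z. \<chi> j. \<Sum>i\<in>UNIV. a z $ i * space_deriv i (\<lambda>y. v y $ j) z)"

text \<open>
  Phases are the indices \<open>1, \<dots>, N\<close>; values of the fields at other indices play no role.
  In the last three components the arguments \<open>p q\<close> are in the order of the
  subscripts of $\zeta^I_{p,q}$, $P^I_{p,q}$ and $Q^I_{p\leftarrow q}$.
\<close>

record ('d::finite) phase_fields =
  alpha     :: "nat \<Rightarrow> ('d, real) field"
  rho       :: "nat \<Rightarrow> ('d, real) field"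
  eint      :: "nat \<Rightarrow> ('d, real) field"
  pres      :: "nat \<Rightarrow> ('d, real) field"
  vel       :: "('d, real ^ 'd) field"
  pf_flux   :: "nat \<Rightarrow> ('d, real ^ 'd) field"
  stress    :: "nat \<Rightarrow> ('d, real ^ 'd ^ 'd) field"
  heat_flux :: "nat \<Rightarrow> ('d, real ^ 'd) field"
  zeta_I    :: "nat \<Rightarrow> nat \<Rightarrow> ('d, real) field"
  pres_I    :: "nat \<Rightarrow> nat \<Rightarrow> ('d, real) field"
  heat_I    :: "nat \<Rightarrow> nat \<Rightarrow> ('d, real) field"

definition smooth_fields :: "nat \<Rightarrow> 'd::finite phase_fields \<Rightarrow> bool" where
  "smooth_fields N M \<longleftrightarrow> smooth (vel M) \<and>
     (\<forall>p\<in>{1..N}. smooth (alpha M p) \<and> smooth (rho M p) \<and> smooth (eint M p) \<and> smooth (pres M p) \<and>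
        smooth (pf_flux M p) \<and> smooth (stress M p) \<and> smooth (heat_flux M p)) \<and>
     (\<forall>p\<in>{1..N}. \<forall>q\<in>{1..N}. smooth (zeta_I M p q) \<and> smooth (pres_I M p q) \<and> smooth (heat_I M p q))"

definition mixture_density :: "nat \<Rightarrow> 'd::finite phase_fields \<Rightarrow> ('d, real) field" where
  "mixture_density N M = (\<lambda>z. \<Sum>q=1..N. alpha M q z * rho M q z)"

definition total_energy :: "'d::finite phase_fields \<Rightarrow> nat \<Rightarrow> ('d, real) field" where
  "total_energy M p = (\<lambda>z. eint M p z + 1 / 2 * (vel M z \<bullet> vel M z))"

definition volume_flux :: "'d::finite phase_fields \<Rightarrow> nat \<Rightarrow> ('d, real ^ 'd) field" where
  "volume_flux M p = (\<lambda>z. alpha M p z *\<^sub>R vel M z - pf_flux M p z)"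

definition interfacial_force :: "nat \<Rightarrow> 'd::finite phase_fields \<Rightarrow> nat \<Rightarrow> nat \<Rightarrow> ('d, real ^ 'd) field" where
  "interfacial_force N M p q = (\<lambda>z.
       (alpha M p z * rho M p z / mixture_density N M z) *\<^sub>R
         tensor_divergence (\<lambda>y. alpha M q y *\<^sub>R stress M q y) z
     - (alpha M q z * rho M q z / mixture_density N M z) *\<^sub>R
         tensor_divergence (\<lambda>y. alpha M p y *\<^sub>R stress M p y) z
     + (alpha M p z * rho M p z / mixture_density N M z) *\<^sub>R
         advect (\<lambda>y. rho M q y *\<^sub>R pf_flux M q y) (vel M) z
     - (alpha M q z * rho M q z / mixture_density N M z) *\<^sub>R
         advect (\<lambda>y. rho M p y *\<^sub>R pf_flux M p y) (vel M) z)"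

definition mass_equation :: "'d::finite phase_fields \<Rightarrow> nat \<Rightarrow> bool" where
  "mass_equation M p \<longleftrightarrow> (\<forall>z.
     time_deriv (\<lambda>y. alpha M p y * rho M p y) z
       + divergence (\<lambda>y. rho M p y *\<^sub>R volume_flux M p y) z = 0)"

definition momentum_equation :: "nat \<Rightarrow> 'd::finite phase_fields \<Rightarrow> bool" where
  "momentum_equation N M \<longleftrightarrow> (\<forall>z.
     time_deriv (\<lambda>y. mixture_density N M y *\<^sub>R vel M y) z
       + tensor_divergence (\<lambda>y. \<Sum>q=1..N. outer (rho M q y *\<^sub>R volume_flux M q y) (vel M y)) z
     = tensor_divergence (\<lambda>y. \<Sum>q=1..N. alpha M q y *\<^sub>R stress M q y) z)"

text \<open>
  The product \<open>u \<cdot> \<sigma>\<close> has components \<open>\<Sum>\<^sub>j \<sigma>\<^sub>i\<^sub>j u\<^sub>j\<close>, hence is \<open>\<sigma> *v u\<close> (and not \<open>u v* \<sigma>\<close>).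
\<close>

definition energy_equation :: "nat \<Rightarrow> 'd::finite phase_fields \<Rightarrow> nat \<Rightarrow> bool" where
  "energy_equation N M p \<longleftrightarrow> (\<forall>z.
     time_deriv (\<lambda>y. alpha M p y * rho M p y * total_energy M p y) z
       + divergence (\<lambda>y. (rho M p y * total_energy M p y) *\<^sub>R volume_flux M p y) z
     = divergence (\<lambda>y. alpha M p y *\<^sub>R (stress M p y *v vel M y)) z
       - divergence (\<lambda>y. alpha M p y *\<^sub>R heat_flux M p y) z
       + (\<Sum>q=1..N. vel M z \<bullet> interfacial_force N M p q z)
       - (\<Sum>q=1..N. zeta_I M p q z * pres_I M p q z * (pres M p z - pres M q z))
       + (\<Sum>q=1..N. heat_I M p q z))"

definition volume_fraction_equation :: "nat \<Rightarrow> 'd::finite phase_fields \<Rightarrow> nat \<Rightarrow> bool" where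
  "volume_fraction_equation N M p \<longleftrightarrow> (\<forall>z.
     time_deriv (alpha M p) z + divergence (volume_flux M p) z
     = alpha M p z * divergence (vel M) z
       + (\<Sum>q=1..N. zeta_I M p q z * (pres M p z - pres M q z)))"

definition six_equation_model :: "nat \<Rightarrow> 'd::finite phase_fields \<Rightarrow> bool" where
  "six_equation_model N M \<longleftrightarrow>
     (\<forall>p\<in>{1..N}. mass_equation M p) \<and>
     momentum_equation N M \<and>
     (\<forall>p\<in>{1..N}. energy_equation N M p) \<and>
     (\<forall>p\<in>{1..N}. volume_fraction_equation N M p)"

definition boost :: "real ^ 'd::finite \<Rightarrow> ('d, 'b) field \<Rightarrow> ('d, 'b) field" where
  "boost u0 f = (\<lambda>(x, t). f (x + t *\<^sub>R u0, t))"

definition moving_frame :: "real ^ 'd::finite \<Rightarrow> 'd phase_fields \<Rightarrow> 'd phase_fields" where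
  "moving_frame u0 M = \<lparr>
     alpha     = (\<lambda>p. boost u0 (alpha M p)),
     rho       = (\<lambda>p. boost u0 (rho M p)),
     eint      = (\<lambda>p. boost u0 (eint M p)),
     pres      = (\<lambda>p. boost u0 (pres M p)),
     vel       = (\<lambda>z. boost u0 (vel M) z - u0),
     pf_flux   = (\<lambda>p. boost u0 (pf_flux M p)),
     stress    = (\<lambda>p. boost u0 (stress M p)),
     heat_flux = (\<lambda>p. boost u0 (heat_flux M p)),
     zeta_I    = (\<lambda>p q. boost u0 (zeta_I M p q)),
     pres_I    = (\<lambda>p q. boost u0 (pres_I M p q)),
     heat_I    = (\<lambda>p q. boost u0 (heat_I M p q)) \<rparr>"

end

theory Submission
  imports Defs
begin

text \<open>
  Let \<open>m\<^sub>p = \<rho>\<^sub>p (\<alpha>\<^sub>p u - J\<^sub>p)\<close>. Modulo the mass equations, each conservative transport operator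
  \<open>\<partial>\<^sub>t(\<alpha>\<^sub>p \<rho>\<^sub>p f) + div (f m\<^sub>p)\<close> is the derivative of \<open>f\<close> in the spacetime direction
  \<open>(m\<^sub>p, \<alpha>\<^sub>p \<rho>\<^sub>p)\<close>. The momentum equation shows that the total force on phase \<open>p\<close>, including the
  interfacial one, is the derivative of \<open>u\<close> in that direction; its power cancels the kinetic part
  of the energy equation and leaves an equation for the internal energy. In this form \<open>u\<close> occurs
  only through its gradient and through the directions \<open>(m\<^sub>p, \<alpha>\<^sub>p \<rho>\<^sub>p)\<close>, which the differential
  \<open>(a, s) \<mapsto> (a + s u\<^sub>0, s)\<close> of the Galilean transformation carries from the moving frame to the
  original one.
\<close>

text \<open>This keeps the lower bound of \<open>{1..N}\<close> in the form \<open>1\<close> and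
  spacetime points \<open>z\<close> unsplit, so that the equations keep the shape in which the
  lemmas state them.\<close>

declare One_nat_def [simp del] split_paired_All [simp del]

section \<open>Frechet derivatives evaluated in a direction\<close>

lemma differentiable_vec_nth:
  fixes f :: "'a::real_normed_vector \<Rightarrow> 'b::real_normed_vector ^ 'n::finite"
  assumes "f differentiable F"
  shows "(\<lambda>y. f y $ i) differentiable F"
  using assms unfolding differentiable_def
  by (blast intro: bounded_linear.has_derivative[OF bounded_linear_vec_nth])

lemma frechet_derivative_eqI:
  "(f has_derivative f') (at z) \<Longrightarrow> frechet_derivative f (at z) v = f' v"
  using frechet_derivative_at by metis

lemma frechet_derivative_vec_nth:
  fixes f :: "'a::real_normed_vector \<Rightarrow> 'b::real_normed_vector ^ 'n::finite"
  assumes "f differentiable (at z)"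
  shows "frechet_derivative (\<lambda>y. f y $ i) (at z) v = frechet_derivative f (at z) v $ i"
  using assms
  by (intro frechet_derivative_eqI bounded_linear.has_derivative[OF bounded_linear_vec_nth])
    (simp add: frechet_derivative_works[symmetric])

lemma frechet_derivative_sum_apply:
  assumes "\<And>q. q \<in> I \<Longrightarrow> f q differentiable (at z)"
  shows "frechet_derivative (\<lambda>y. \<Sum>q\<in>I. f q y) (at z) v = (\<Sum>q\<in>I. frechet_derivative (f q) (at z) v)"
  using assms by (intro frechet_derivative_eqI has_derivative_sum) (simp add: frechet_derivative_works[symmetric])

lemma frechet_derivative_add_apply:
  assumes "f differentiable (at z)" "g differentiable (at z)"
  shows "frechet_derivative (\<lambda>y. f y + g y) (at z) v = frechet_derivative f (at z) v + frechet_derivative g (at z) v"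
  using assms by (intro frechet_derivative_eqI has_derivative_add) (simp_all add: frechet_derivative_works[symmetric])

lemma frechet_derivative_diff_apply:
  assumes "f differentiable (at z)" "g differentiable (at z)"
  shows "frechet_derivative (\<lambda>y. f y - g y) (at z) v = frechet_derivative f (at z) v - frechet_derivative g (at z) v"
  using assms by (intro frechet_derivative_eqI has_derivative_diff) (simp_all add: frechet_derivative_works[symmetric])

lemma frechet_derivative_inner_apply:
  assumes "f differentiable (at z)" "g differentiable (at z)"
  shows "frechet_derivative (\<lambda>y. f y \<bullet> g y) (at z) v
    = f z \<bullet> frechet_derivative g (at z) v + frechet_derivative f (at z) v \<bullet> g z"
  using assms by (intro frechet_derivative_eqI has_derivative_inner) (simp_all add: frechet_derivative_works[symmetric])

lemma frechet_derivative_scaleR_apply: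
  assumes "f differentiable (at z)" "g differentiable (at z)"
  shows "frechet_derivative (\<lambda>y. f y *\<^sub>R g y) (at z) v
    = f z *\<^sub>R frechet_derivative g (at z) v + frechet_derivative f (at z) v *\<^sub>R g z"
  using assms by (intro frechet_derivative_eqI has_derivative_scaleR) (simp_all add: frechet_derivative_works[symmetric])

lemma frechet_derivative_mult_apply:
  fixes f g :: "'a::real_normed_vector \<Rightarrow> real"
  assumes "f differentiable (at z)" "g differentiable (at z)"
  shows "frechet_derivative (\<lambda>y. f y * g y) (at z) v
    = f z * frechet_derivative g (at z) v + frechet_derivative f (at z) v * g z"
  using frechet_derivative_scaleR_apply[OF assms] by simp

section \<open>Time and space operators as values of one Frechet derivative\<close>

lemma time_deriv_eq_frechet:
  assumes "f differentiable (at z)"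
  shows "time_deriv f z = frechet_derivative f (at z) (0, 1)"
proof -
  obtain x t where z: "z = (x, t)" by force
  have f: "(f has_derivative frechet_derivative f (at z)) (at (x, t))"
    using assms by (simp add: z frechet_derivative_works[symmetric])
  have "((\<lambda>s. (x, s)) has_derivative (\<lambda>s. (0, s))) (at t)"
    by (auto intro!: derivative_eq_intros)
  from has_derivative_compose[OF this, of f] f
  have "((\<lambda>s. f (x, s)) has_derivative (\<lambda>s. frechet_derivative f (at z) (0, s))) (at t)"
    by simp
  moreover have "(\<lambda>s. frechet_derivative f (at z) (0, s)) = (\<lambda>s. s *\<^sub>R frechet_derivative f (at z) (0, 1))"
  proof
    fix s
    show "frechet_derivative f (at z) (0, s) = s *\<^sub>R frechet_derivative f (at z) (0, 1)"
      using linear_scale[OF has_derivative_linear[OF f], of s "(0, 1)"] by simp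
  qed
  ultimately have "((\<lambda>s. f (x, s)) has_vector_derivative frechet_derivative f (at z) (0, 1)) (at t)"
    by (simp only: has_vector_derivative_def)
  then show ?thesis by (simp add: time_deriv_def z vector_derivative_at)
qed

lemma space_deriv_eq_frechet:
  assumes "f differentiable (at z)"
  shows "space_deriv i f z = frechet_derivative f (at z) (axis i 1, 0)"
proof -
  obtain x t where z: "z = (x, t)" by force
  have f: "(f has_derivative frechet_derivative f (at z)) (at (x, t))"
    using assms by (simp add: z frechet_derivative_works[symmetric])
  have "((\<lambda>s. (x + s *\<^sub>R axis i 1, t)) has_derivative (\<lambda>s. (s *\<^sub>R axis i 1, 0))) (at 0)"
    by (auto intro!: derivative_eq_intros)
  from has_derivative_compose[OF this, of f] f
  have "((\<lambda>s. f (x + s *\<^sub>R axis i 1, t)) has_derivative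
      (\<lambda>s. frechet_derivative f (at z) (s *\<^sub>R axis i 1, 0))) (at 0)"
    by simp
  moreover have "(\<lambda>s. frechet_derivative f (at z) (s *\<^sub>R axis i 1, 0))
      = (\<lambda>s. s *\<^sub>R frechet_derivative f (at z) (axis i 1, 0))"
  proof
    fix s
    show "frechet_derivative f (at z) (s *\<^sub>R axis i 1, 0) = s *\<^sub>R frechet_derivative f (at z) (axis i 1, 0)"
      using linear_scale[OF has_derivative_linear[OF f], of s "(axis i 1, 0)"] by simp
  qed
  ultimately have "((\<lambda>s. f (x + s *\<^sub>R axis i 1, t)) has_vector_derivative
      frechet_derivative f (at z) (axis i 1, 0)) (at 0)"
    by (simp only: has_vector_derivative_def)
  then show ?thesis by (simp add: space_deriv_def z vector_derivative_at)
qed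

text \<open>Linearity on the basis expansion of a. From right to left it collapses the sums over a_i
  times the i-th partial derivative, which come from advection and the product rule, into one
  directional derivative.\<close>

lemma frechet_derivative_space_expand:
  fixes f :: "(real ^ 'd::finite) \<times> real \<Rightarrow> 'b::real_normed_vector"
  assumes "f differentiable (at z)"
  shows "frechet_derivative f (at z) (a, 0)
    = (\<Sum>i\<in>UNIV. a $ i *\<^sub>R frechet_derivative f (at z) (axis i 1, 0))"
proof -
  have lin: "linear (frechet_derivative f (at z))"
    using assms by (rule linear_frechet_derivative)
  have a: "(a, 0 :: real) = (\<Sum>i\<in>UNIV. a $ i *\<^sub>R (axis i 1, 0))"
    using basis_expansion[of a] by (simp add: prod_eq_iff fst_sum snd_sum scalar_mult_eq_scaleR)
  show ?thesis
    by (simp only: a linear_sum[OF lin] linear_scale[OF lin])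
qed

lemma frechet_derivative_spacetime_split:
  fixes f :: "(real ^ 'd::finite) \<times> real \<Rightarrow> 'b::real_normed_vector"
  assumes "f differentiable (at z)"
  shows "frechet_derivative f (at z) (a, s)
    = s *\<^sub>R frechet_derivative f (at z) (0, 1) + frechet_derivative f (at z) (a, 0)"
proof -
  have lin: "linear (frechet_derivative f (at z))"
    using assms by (rule linear_frechet_derivative)
  have "(a, s) = s *\<^sub>R (0, 1) + (a, 0)" by simp
  then show ?thesis by (simp only: linear_add[OF lin] linear_scale[OF lin])
qed

lemma divergence_eq_frechet:
  assumes "a differentiable (at z)"
  shows "divergence a z = (\<Sum>i\<in>UNIV. frechet_derivative a (at z) (axis i 1, 0) $ i)"
  using assms
  by (simp add: divergence_def space_deriv_eq_frechet differentiable_vec_nth frechet_derivative_vec_nth)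

lemma divergence_sum:
  assumes "\<And>q. q \<in> I \<Longrightarrow> a q differentiable (at z)"
  shows "divergence (\<lambda>y. \<Sum>q\<in>I. a q y) z = (\<Sum>q\<in>I. divergence (a q) z)"
proof (cases "finite I")
  case True
  then show ?thesis
    using assms
    by (simp add: divergence_eq_frechet differentiable_sum frechet_derivative_sum_apply sum.swap[of _ I])
next
  case False
  \<comment> \<open>Sums over an infinite index set are 0 by convention, so both sides
    vanish.\<close>
  then show ?thesis by (simp add: divergence_eq_frechet)
qed

lemma divergence_diff:
  assumes "a differentiable (at z)" "b differentiable (at z)"
  shows "divergence (\<lambda>y. a y - b y) z = divergence a z - divergence b z"
  using assms by (simp add: divergence_eq_frechet frechet_derivative_diff_apply sum_subtractf)

lemma divergence_scaleR:
  assumes "f differentiable (at z)" "a differentiable (at z)"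
  shows "divergence (\<lambda>y. f y *\<^sub>R a y) z = f z * divergence a z + frechet_derivative f (at z) (a z, 0)"
  using assms
  by (simp add: divergence_eq_frechet differentiable_scaleR frechet_derivative_scaleR_apply
      frechet_derivative_space_expand[of f z "a z"] sum.distrib sum_distrib_left mult.commute)

text \<open>The contraction runs over the row index, so columns carry the divergence. This reduces
  identities for matrix fields to those for vector fields.\<close>

lemma tensor_divergence_nth:
  "tensor_divergence S z $ j = divergence (\<lambda>y. column j (S y)) z"
  by (simp add: tensor_divergence_def divergence_def column_def)

lemma differentiable_column:
  fixes S :: "'a::real_normed_vector \<Rightarrow> real ^ 'm::finite ^ 'n::finite"
  assumes "S differentiable F"
  shows "(\<lambda>y. column j (S y)) differentiable F"
proof -
  have "bounded_linear (column j :: real ^ 'm ^ 'n \<Rightarrow> real ^ 'n)"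
    unfolding linear_conv_bounded_linear[symmetric]
    by (rule linearI) (simp_all add: column_def vec_eq_iff)
  then show ?thesis
    using assms unfolding differentiable_def by (blast intro: bounded_linear.has_derivative)
qed

lemma tensor_divergence_sum:
  assumes "\<And>q j. q \<in> I \<Longrightarrow> (\<lambda>y. column j (S q y)) differentiable (at z)"
  shows "tensor_divergence (\<lambda>y. \<Sum>q\<in>I. S q y) z = (\<Sum>q\<in>I. tensor_divergence (S q) z)"
proof -
  have "column j (\<Sum>q\<in>I. S q y) = (\<Sum>q\<in>I. column j (S q y))" for j y
    by (simp add: vec_eq_iff column_def)
  then show ?thesis
    using assms by (subst vec_eq_iff) (simp add: tensor_divergence_nth divergence_sum)
qed

lemma column_outer: "column j (outer a b) = b $ j *\<^sub>R a"
  by (simp add: vec_eq_iff column_def outer_def)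

lemma tensor_divergence_outer:
  assumes "a differentiable (at z)" "v differentiable (at z)"
  shows "tensor_divergence (\<lambda>y. outer (a y) (v y)) z
    = divergence a z *\<^sub>R v z + frechet_derivative v (at z) (a z, 0)"
  using assms
  by (simp add: vec_eq_iff tensor_divergence_nth column_outer divergence_scaleR
      differentiable_vec_nth frechet_derivative_vec_nth)

text \<open>S v is the combination of the columns of S with coefficients v_j, and the product rule
  applies to each term. The remaining sum is the full contraction of S with the gradient of v, that
  is, the stress power when S is the stress and v the velocity.\<close>

lemma divergence_matrix_vector_mult:
  assumes "S differentiable (at z)" "v differentiable (at z)"
  shows "divergence (\<lambda>y. S y *v v y) z
    = v z \<bullet> tensor_divergence S z
      + (\<Sum>j\<in>UNIV. frechet_derivative v (at z) (column j (S z), 0) $ j)"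
  using assms
  by (simp add: matrix_mult_sum scalar_mult_eq_scaleR divergence_sum divergence_scaleR
      differentiable_vec_nth differentiable_column frechet_derivative_vec_nth
      tensor_divergence_nth inner_vec_def sum.distrib)

lemma advect_eq_frechet:
  assumes "v differentiable (at z)"
  shows "advect a v z = frechet_derivative v (at z) (a z, 0)"
  using assms
  by (simp add: vec_eq_iff advect_def space_deriv_eq_frechet differentiable_vec_nth
      frechet_derivative_vec_nth frechet_derivative_space_expand[of v z "a z"])

text \<open>The product rule yields f times the balance of A, which is zero, and the time and space
  derivatives of f combine into its derivative in the direction (m, A).\<close>

lemma conservative_transport:
  assumes "A differentiable (at z)" "m differentiable (at z)" "f differentiable (at z)"
    and "time_deriv A z + divergence m z = 0"
  shows "time_deriv (\<lambda>y. A y * f y) z + divergence (\<lambda>y. f y *\<^sub>R m y) z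
    = frechet_derivative f (at z) (m z, A z)"
proof -
  have "time_deriv (\<lambda>y. A y * f y) z + divergence (\<lambda>y. f y *\<^sub>R m y) z
      = f z * (time_deriv A z + divergence m z) + frechet_derivative f (at z) (m z, A z)"
    using assms(1-3)
    by (simp add: time_deriv_eq_frechet divergence_scaleR frechet_derivative_mult_apply
        frechet_derivative_spacetime_split[of f z "m z" "A z"] algebra_simps)
  then show ?thesis using assms(4) by simp
qed

lemma conservative_transport_vec:
  assumes "A differentiable (at z)" "m differentiable (at z)" "v differentiable (at z)"
    and "time_deriv A z + divergence m z = 0"
  shows "time_deriv (\<lambda>y. A y *\<^sub>R v y) z + tensor_divergence (\<lambda>y. outer (m y) (v y)) z
    = frechet_derivative v (at z) (m z, A z)"
proof -
  have "time_deriv (\<lambda>y. A y *\<^sub>R v y) z + tensor_divergence (\<lambda>y. outer (m y) (v y)) z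
      = (time_deriv A z + divergence m z) *\<^sub>R v z + frechet_derivative v (at z) (m z, A z)"
    using assms(1-3)
    by (simp add: time_deriv_eq_frechet tensor_divergence_outer frechet_derivative_scaleR_apply
        frechet_derivative_spacetime_split[of v z "m z" "A z"] algebra_simps)
  then show ?thesis using assms(4) by simp
qed

section \<open>The Galilean point transformation and the chain rule\<close>

definition galilean :: "real ^ 'd::finite \<Rightarrow> (real ^ 'd) \<times> real \<Rightarrow> (real ^ 'd) \<times> real" where
  "galilean u0 = (\<lambda>(x, t). (x + t *\<^sub>R u0, t))"

lemma boost_apply: "boost u0 f z = f (galilean u0 z)"
  by (simp add: boost_def galilean_def split: prod.split)

lemma has_derivative_galilean:
  "(galilean u0 has_derivative (\<lambda>(a, s). (a + s *\<^sub>R u0, s))) (at z)"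
  unfolding galilean_def case_prod_beta by (auto intro!: derivative_eq_intros)

lemma boost_has_derivative:
  assumes "f differentiable (at (galilean u0 z))"
  shows "(boost u0 f has_derivative
    (\<lambda>(a, s). frechet_derivative f (at (galilean u0 z)) (a + s *\<^sub>R u0, s))) (at z)"
proof -
  have "boost u0 f = (\<lambda>z. f (galilean u0 z))" by (simp add: fun_eq_iff boost_apply)
  moreover have "(f has_derivative frechet_derivative f (at (galilean u0 z))) (at (galilean u0 z))"
    using assms by (simp add: frechet_derivative_works[symmetric])
  ultimately show ?thesis
    using has_derivative_compose[OF has_derivative_galilean] by (simp add: case_prod_unfold)
qed

lemma differentiable_boost:
  "f differentiable (at (galilean u0 z)) \<Longrightarrow> boost u0 f differentiable (at z)"
  using boost_has_derivative differentiable_def by blast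

lemma frechet_derivative_boost:
  assumes "f differentiable (at (galilean u0 z))"
  shows "frechet_derivative (boost u0 f) (at z) (a, s)
    = frechet_derivative f (at (galilean u0 z)) (a + s *\<^sub>R u0, s)"
  using frechet_derivative_eqI[OF boost_has_derivative[OF assms]] by simp

text \<open>At a fixed time the transformation is a spatial translation, so the two derivatives are
  taken of the same function of s.\<close>

lemma space_deriv_boost: "space_deriv i (boost u0 f) z = space_deriv i f (galilean u0 z)"
  by (cases z) (simp add: space_deriv_def boost_def galilean_def algebra_simps)

lemma divergence_boost: "divergence (boost u0 a) z = divergence a (galilean u0 z)"
proof -
  have "(\<lambda>y. boost u0 a y $ i) = boost u0 (\<lambda>y. a y $ i)" for i
    by (simp add: fun_eq_iff boost_apply)
  then show ?thesis by (simp add: divergence_def space_deriv_boost)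
qed

lemma tensor_divergence_boost:
  "tensor_divergence (boost u0 S) z = tensor_divergence S (galilean u0 z)"
proof -
  have "(\<lambda>y. column j (boost u0 S y)) = boost u0 (\<lambda>y. column j (S y))" for j
    by (simp add: fun_eq_iff boost_apply)
  then show ?thesis by (simp add: vec_eq_iff tensor_divergence_nth divergence_boost)
qed

lemma smooth_imp_differentiable:
  assumes "smooth f"
  shows "f differentiable (at z)"
proof -
  have "C_k (Suc 0) f" using assms unfolding smooth_def by blast
  then show ?thesis by simp
qed

section \<open>Phasic mass, mass flux and stress\<close>

definition phase_mass :: "'d::finite phase_fields \<Rightarrow> nat \<Rightarrow> ('d, real) field" where
  "phase_mass M p = (\<lambda>z. alpha M p z * rho M p z)"

text \<open>This is the m_p of the opening comment. Paired with \<open>phase_mass\<close> it gives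
  the transport direction of phase p.\<close>

definition mass_flux :: "'d::finite phase_fields \<Rightarrow> nat \<Rightarrow> ('d, real ^ 'd) field" where
  "mass_flux M p = (\<lambda>z. rho M p z *\<^sub>R volume_flux M p z)"

definition phase_stress :: "'d::finite phase_fields \<Rightarrow> nat \<Rightarrow> ('d, real ^ 'd ^ 'd) field" where
  "phase_stress M p = (\<lambda>z. alpha M p z *\<^sub>R stress M p z)"

lemma mass_equation_altdef:
  "mass_equation M p \<longleftrightarrow> (\<forall>z. time_deriv (phase_mass M p) z + divergence (mass_flux M p) z = 0)"
  by (simp add: mass_equation_def phase_mass_def mass_flux_def)

lemma mixture_density_altdef: "mixture_density N M = (\<lambda>z. \<Sum>q=1..N. phase_mass M q z)"
  by (simp add: mixture_density_def phase_mass_def)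

text \<open>Interpreted twice, for the given fields and for those of the moving frame, so that the
  reformulations below hold in both frames. Pointwise differentiability passes to the moving frame
  by the chain rule.\<close>

locale differentiable_model =
  fixes N :: nat and M :: "'d::finite phase_fields"
  assumes vel_diff: "vel M differentiable (at z)"
    and alpha_diff: "p \<in> {1..N} \<Longrightarrow> alpha M p differentiable (at z)"
    and rho_diff: "p \<in> {1..N} \<Longrightarrow> rho M p differentiable (at z)"
    and eint_diff: "p \<in> {1..N} \<Longrightarrow> eint M p differentiable (at z)"
    and pf_flux_diff: "p \<in> {1..N} \<Longrightarrow> pf_flux M p differentiable (at z)"
    and stress_diff: "p \<in> {1..N} \<Longrightarrow> stress M p differentiable (at z)"
begin

section \<open>Momentum and energy equations in nonconservative form\<close>

lemma phase_mass_diff: "p \<in> {1..N} \<Longrightarrow> phase_mass M p differentiable (at z)"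
  by (simp add: phase_mass_def alpha_diff rho_diff)

lemma volume_flux_diff: "p \<in> {1..N} \<Longrightarrow> volume_flux M p differentiable (at z)"
  by (simp add: volume_flux_def alpha_diff vel_diff pf_flux_diff)

lemma mass_flux_diff: "p \<in> {1..N} \<Longrightarrow> mass_flux M p differentiable (at z)"
  by (simp add: mass_flux_def volume_flux_diff rho_diff)

lemma phase_stress_diff: "p \<in> {1..N} \<Longrightarrow> phase_stress M p differentiable (at z)"
  by (simp add: phase_stress_def alpha_diff stress_diff)

lemma total_energy_diff: "p \<in> {1..N} \<Longrightarrow> total_energy M p differentiable (at z)"
  by (simp add: total_energy_def eint_diff vel_diff)

text \<open>Summed over the phases, the mass equations give a balance for the mixture density with
  the total mass flux. All outer products share the factor u, so
  \<open>conservative_transport_vec\<close> applies to the mixture as a whole.\<close>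

lemma momentum_equation_iff:
  assumes mass: "\<And>p. p \<in> {1..N} \<Longrightarrow> mass_equation M p"
  shows "momentum_equation N M \<longleftrightarrow> (\<forall>z.
    frechet_derivative (vel M) (at z) (\<Sum>q=1..N. mass_flux M q z, mixture_density N M z)
      = (\<Sum>q=1..N. tensor_divergence (phase_stress M q) z))"
proof -
  have outer: "(\<Sum>q=1..N. outer (rho M q y *\<^sub>R volume_flux M q y) (vel M y))
      = outer (\<Sum>q=1..N. mass_flux M q y) (vel M y)" for y
    by (simp add: vec_eq_iff outer_def mass_flux_def sum_distrib_right)
  have "time_deriv (mixture_density N M) z + divergence (\<lambda>y. \<Sum>q=1..N. mass_flux M q y) z = 0" for z
  proof -
    have "time_deriv (mixture_density N M) z = (\<Sum>q=1..N. time_deriv (phase_mass M q) z)"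
      by (simp add: mixture_density_altdef time_deriv_eq_frechet phase_mass_diff)
        (rule frechet_derivative_sum_apply, rule phase_mass_diff)
    moreover have "divergence (\<lambda>y. \<Sum>q=1..N. mass_flux M q y) z = (\<Sum>q=1..N. divergence (mass_flux M q) z)"
      by (rule divergence_sum, rule mass_flux_diff)
    ultimately show ?thesis
      using mass by (simp add: sum.distrib[symmetric] mass_equation_altdef)
  qed
  then have "time_deriv (\<lambda>y. mixture_density N M y *\<^sub>R vel M y) z
      + tensor_divergence (\<lambda>y. outer (\<Sum>q=1..N. mass_flux M q y) (vel M y)) z
    = frechet_derivative (vel M) (at z) (\<Sum>q=1..N. mass_flux M q z, mixture_density N M z)" for z
    by (intro conservative_transport_vec)
      (simp_all add: mixture_density_altdef phase_mass_diff mass_flux_diff vel_diff)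
  moreover have "tensor_divergence (\<lambda>y. \<Sum>q=1..N. alpha M q y *\<^sub>R stress M q y) z
      = (\<Sum>q=1..N. tensor_divergence (phase_stress M q) z)" for z
    using tensor_divergence_sum[of "{1..N}" "phase_stress M" z]
    by (simp add: differentiable_column phase_stress_diff) (simp add: phase_stress_def)
  ultimately show ?thesis by (simp add: momentum_equation_def outer)
qed

text \<open>With A_q the phasic mass, r the mixture density, T_q the stress divergence and G_q the
  derivative of u along the Phase-Field mass flux, the force is (A_p/r)(T_q + G_q) - (A_q/r)(T_p +
  G_p). The momentum equation evaluates the sum of all T_q + G_q, so summation over q leaves only
  quantities of phase p and the acceleration of the mixture.\<close>

lemma sum_interfacial_force:
  assumes p: "p \<in> {1..N}" and rho: "mixture_density N M z \<noteq> 0"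
    and momentum: "frechet_derivative (vel M) (at z)
        (\<Sum>q=1..N. mass_flux M q z, mixture_density N M z)
      = (\<Sum>q=1..N. tensor_divergence (phase_stress M q) z)"
  shows "(\<Sum>q=1..N. interfacial_force N M p q z)
    = frechet_derivative (vel M) (at z) (mass_flux M p z, phase_mass M p z)
      - tensor_divergence (phase_stress M p) z"
proof -
  let ?D = "frechet_derivative (vel M) (at z)" and ?r = "mixture_density N M z"
  define T where "T q = tensor_divergence (phase_stress M q) z" for q
  define G where "G q = ?D (rho M q z *\<^sub>R pf_flux M q z, 0)" for q
  define A where "A q = phase_mass M q z" for q
  \<comment> \<open>K is the material derivative of u along the common velocity.\<close>
  define K where "K = ?D (vel M z, 1)"
  have lin: "linear ?D" by (intro linear_frechet_derivative vel_diff)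
  \<comment> \<open>The transport direction of a phase is A_q (u, 1) corrected by its Phase-Field
    mass flux.\<close>
  have D: "?D (mass_flux M q z, phase_mass M q z) = A q *\<^sub>R K - G q" for q
  proof -
    have "(mass_flux M q z, phase_mass M q z)
        = phase_mass M q z *\<^sub>R (vel M z, 1) - (rho M q z *\<^sub>R pf_flux M q z, 0)"
      by (simp add: mass_flux_def volume_flux_def phase_mass_def algebra_simps)
    then show ?thesis
      by (simp only: linear_diff[OF lin] linear_scale[OF lin] A_def K_def G_def)
  qed
  have r: "(\<Sum>q=1..N. A q) = ?r" by (simp add: mixture_density_altdef A_def)
  have "(\<Sum>q=1..N. T q) = ?D (\<Sum>q=1..N. (mass_flux M q z, phase_mass M q z))"
    using momentum by (simp add: sum_prod T_def mixture_density_altdef)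
  also have "\<dots> = ?r *\<^sub>R K - (\<Sum>q=1..N. G q)"
    by (simp add: linear_sum[OF lin] D sum_subtractf scaleR_sum_left[symmetric] r)
  \<comment> \<open>The total force T_q + G_q of the mixture equals its mass times the acceleration
    K.\<close>
  finally have TG: "(\<Sum>q=1..N. T q + G q) = ?r *\<^sub>R K" by (simp add: sum.distrib)
  have "interfacial_force N M p q z
      = (A p / ?r) *\<^sub>R (T q + G q) - (A q / ?r) *\<^sub>R (T p + G p)" for q
    by (simp add: interfacial_force_def A_def phase_mass_def T_def G_def phase_stress_def
        advect_eq_frechet vel_diff algebra_simps)
  then have "(\<Sum>q=1..N. interfacial_force N M p q z)
      = (A p / ?r) *\<^sub>R (\<Sum>q=1..N. T q + G q) - ((\<Sum>q=1..N. A q) / ?r) *\<^sub>R (T p + G p)"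
    by (simp only: sum_subtractf scaleR_sum_right scaleR_sum_left sum_divide_distrib)
  also have "\<dots> = A p *\<^sub>R K - (T p + G p)"
    using rho by (simp add: TG r)
  finally show ?thesis by (simp add: D T_def)
qed

text \<open>Along the transport direction the kinetic energy changes by u . Du. The interfacial
  power equals u . Du - u . T_p by \<open>sum_interfacial_force\<close>, and the stress work
  contains u . T_p, so every term in which u itself is a factor cancels.\<close>

lemma energy_equation_iff:
  assumes p: "p \<in> {1..N}" and mass: "mass_equation M p"
    and rho: "\<And>z. mixture_density N M z \<noteq> 0"
    and momentum: "\<And>z. frechet_derivative (vel M) (at z)
        (\<Sum>q=1..N. mass_flux M q z, mixture_density N M z)
      = (\<Sum>q=1..N. tensor_divergence (phase_stress M q) z)"
  shows "energy_equation N M p \<longleftrightarrow> (\<forall>z.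
    frechet_derivative (eint M p) (at z) (mass_flux M p z, phase_mass M p z)
    = (\<Sum>j\<in>UNIV. frechet_derivative (vel M) (at z) (column j (phase_stress M p z), 0) $ j)
      - divergence (\<lambda>y. alpha M p y *\<^sub>R heat_flux M p y) z
      - (\<Sum>q=1..N. zeta_I M p q z * pres_I M p q z * (pres M p z - pres M q z))
      + (\<Sum>q=1..N. heat_I M p q z))"
proof -
  have transport: "time_deriv (\<lambda>y. alpha M p y * rho M p y * total_energy M p y) z
       + divergence (\<lambda>y. (rho M p y * total_energy M p y) *\<^sub>R volume_flux M p y) z
     = frechet_derivative (eint M p) (at z) (mass_flux M p z, phase_mass M p z)
       + vel M z \<bullet> frechet_derivative (vel M) (at z) (mass_flux M p z, phase_mass M p z)" for z
  proof -
    have "time_deriv (\<lambda>y. phase_mass M p y * total_energy M p y) z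
        + divergence (\<lambda>y. total_energy M p y *\<^sub>R mass_flux M p y) z
      = frechet_derivative (total_energy M p) (at z) (mass_flux M p z, phase_mass M p z)"
      using p mass
      by (intro conservative_transport)
        (simp_all add: phase_mass_diff mass_flux_diff total_energy_diff mass_equation_altdef)
    also have "\<dots> = frechet_derivative (eint M p) (at z) (mass_flux M p z, phase_mass M p z)
       + vel M z \<bullet> frechet_derivative (vel M) (at z) (mass_flux M p z, phase_mass M p z)"
      unfolding total_energy_def using p
      \<comment> \<open>The two equal terms in the derivative of the inner product of u with itself
        absorb the factor 1/2.\<close>
      by (subst frechet_derivative_add_apply frechet_derivative_mult_apply,
          simp_all only: eint_diff vel_diff differentiable_inner differentiable_mult differentiable_const)+
        (simp add: frechet_derivative_inner_apply vel_diff inner_commute)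
    finally show ?thesis by (simp add: phase_mass_def mass_flux_def mult.commute)
  qed
  have stress: "divergence (\<lambda>y. alpha M p y *\<^sub>R (stress M p y *v vel M y)) z
      = vel M z \<bullet> tensor_divergence (phase_stress M p) z
        + (\<Sum>j\<in>UNIV. frechet_derivative (vel M) (at z) (column j (phase_stress M p z), 0) $ j)" for z
    using divergence_matrix_vector_mult[OF phase_stress_diff[OF p] vel_diff, of z]
    by (simp add: phase_stress_def scaleR_matrix_vector_assoc)
  have force: "(\<Sum>q=1..N. vel M z \<bullet> interfacial_force N M p q z)
      = vel M z \<bullet> frechet_derivative (vel M) (at z) (mass_flux M p z, phase_mass M p z)
        - vel M z \<bullet> tensor_divergence (phase_stress M p) z" for z
    by (simp add: inner_sum_right[symmetric] sum_interfacial_force[OF p rho momentum] inner_diff_right)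
  show ?thesis
    \<comment> \<open>Now u . Du stands on both sides, and u . T_p twice on the right with opposite
      signs.\<close>
    unfolding energy_equation_def transport stress force by (intro iff_allI iffI; linarith)
qed

end

section \<open>Fluxes and transport operators in the moving frame\<close>

lemma moving_frame_simps:
  "alpha (moving_frame u0 M) p = boost u0 (alpha M p)"
  "rho (moving_frame u0 M) p = boost u0 (rho M p)"
  "eint (moving_frame u0 M) p = boost u0 (eint M p)"
  "pres (moving_frame u0 M) p = boost u0 (pres M p)"
  "vel (moving_frame u0 M) = (\<lambda>z. boost u0 (vel M) z - u0)"
  "pf_flux (moving_frame u0 M) p = boost u0 (pf_flux M p)"
  "stress (moving_frame u0 M) p = boost u0 (stress M p)"
  "heat_flux (moving_frame u0 M) p = boost u0 (heat_flux M p)"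
  "zeta_I (moving_frame u0 M) p q = boost u0 (zeta_I M p q)"
  "pres_I (moving_frame u0 M) p q = boost u0 (pres_I M p q)"
  "heat_I (moving_frame u0 M) p q = boost u0 (heat_I M p q)"
  by (simp_all add: moving_frame_def)

lemma phase_mass_moving_frame: "phase_mass (moving_frame u0 M) p = boost u0 (phase_mass M p)"
  by (simp add: fun_eq_iff phase_mass_def moving_frame_simps boost_apply)

lemma mixture_density_moving_frame:
  "mixture_density N (moving_frame u0 M) = boost u0 (mixture_density N M)"
  by (simp add: fun_eq_iff mixture_density_altdef phase_mass_moving_frame boost_apply)

lemma phase_stress_moving_frame: "phase_stress (moving_frame u0 M) p = boost u0 (phase_stress M p)"
  by (simp add: fun_eq_iff phase_stress_def moving_frame_simps boost_apply)

lemma volume_flux_moving_frame: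
  "volume_flux (moving_frame u0 M) p = boost u0 (\<lambda>z. volume_flux M p z - alpha M p z *\<^sub>R u0)"
  by (simp add: fun_eq_iff volume_flux_def moving_frame_simps boost_apply algebra_simps)

text \<open>The objective flux J_p is unchanged, so only the convective part loses A_p u0. The
  differential (a, s) to (a + s u0, s) adds exactly this back and turns the new transport direction
  into the old one.\<close>

lemma mass_flux_moving_frame:
  "mass_flux (moving_frame u0 M) p = boost u0 (\<lambda>z. mass_flux M p z - phase_mass M p z *\<^sub>R u0)"
  by (simp add: fun_eq_iff mass_flux_def volume_flux_moving_frame phase_mass_def moving_frame_simps
      boost_apply algebra_simps)

lemma frechet_derivative_vel_moving_frame:
  assumes "vel M differentiable (at (galilean u0 z))"
  shows "frechet_derivative (vel (moving_frame u0 M)) (at z) (a, s)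
    = frechet_derivative (vel M) (at (galilean u0 z)) (a + s *\<^sub>R u0, s)"
  using assms
  by (simp add: moving_frame_simps frechet_derivative_diff_apply differentiable_boost
      frechet_derivative_boost)

lemma time_deriv_boost:
  assumes "f differentiable (at (galilean u0 z))"
  shows "time_deriv (boost u0 f) z
    = time_deriv f (galilean u0 z) + frechet_derivative f (at (galilean u0 z)) (u0, 0)"
  using assms frechet_derivative_spacetime_split[OF assms, of u0 1]
  by (simp add: time_deriv_eq_frechet differentiable_boost frechet_derivative_boost)

text \<open>The time derivative in the moving frame gains the derivative of f along u0, which is
  also the divergence of f u0 because u0 is constant; the two cancel. This serves the mass equation
  with f the phasic mass, and the volume fraction equation with f the volume fraction.\<close>

lemma transport_boost:
  assumes f: "f differentiable (at (galilean u0 z))" and a: "a differentiable (at (galilean u0 z))"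
  shows "time_deriv (boost u0 f) z + divergence (boost u0 (\<lambda>y. a y - f y *\<^sub>R u0)) z
    = time_deriv f (galilean u0 z) + divergence a (galilean u0 z)"
proof -
  have "divergence (\<lambda>y. u0) (galilean u0 z) = 0" by (simp add: divergence_eq_frechet)
  then show ?thesis
    using assms by (simp add: time_deriv_boost divergence_boost divergence_diff divergence_scaleR)
qed

section \<open>The four families of equations in the moving frame\<close>

theorem mainTheorem5:
  fixes N :: nat and M :: "'d::finite phase_fields" and u0 :: "real ^ 'd"
  assumes "N \<ge> 1"
    and "smooth_fields N M"
    and "\<forall>z. mixture_density N M z > 0"
    and "six_equation_model N M"
  shows "six_equation_model N (moving_frame u0 M)"
proof -
  let ?M = "moving_frame u0 M" and ?G = "galilean u0"
  interpret differentiable_model N M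
    by standard (use assms(2) in \<open>auto simp: smooth_fields_def intro!: smooth_imp_differentiable\<close>)
  interpret moving: differentiable_model N ?M
    by standard (simp_all add: moving_frame_simps differentiable_boost vel_diff alpha_diff rho_diff
        eint_diff pf_flux_diff stress_diff)
  have rho: "mixture_density N M z \<noteq> 0" for z
    using assms(3) by (metis less_irrefl)
  have rho': "mixture_density N ?M z \<noteq> 0" for z
    by (simp add: mixture_density_moving_frame boost_apply rho)
  have mass: "mass_equation M p" and energy: "energy_equation N M p"
    and volume: "volume_fraction_equation N M p" if "p \<in> {1..N}" for p
    using assms(4) that by (auto simp: six_equation_model_def)
  have mass': "mass_equation ?M p" if p: "p \<in> {1..N}" for p
    using mass[OF p] p
    by (simp add: mass_equation_altdef phase_mass_moving_frame mass_flux_moving_frame transport_boost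
        phase_mass_diff mass_flux_diff)
  have momentum: "frechet_derivative (vel M) (at z)
        (\<Sum>q=1..N. mass_flux M q z, mixture_density N M z)
      = (\<Sum>q=1..N. tensor_divergence (phase_stress M q) z)" for z
    using assms(4) momentum_equation_iff[OF mass] by (simp add: six_equation_model_def)
  have momentum': "frechet_derivative (vel ?M) (at z)
        (\<Sum>q=1..N. mass_flux ?M q z, mixture_density N ?M z)
      = (\<Sum>q=1..N. tensor_divergence (phase_stress ?M q) z)" for z
  proof -
    \<comment> \<open>The shifts A_q u0 of the phases add up to the mixture density times u0, so the
      direction of the mixture is also carried to the original one.\<close>
    have "(\<Sum>q=1..N. mass_flux ?M q z) + mixture_density N ?M z *\<^sub>R u0
        = (\<Sum>q=1..N. mass_flux M q (?G z))"
      by (simp add: mass_flux_moving_frame mixture_density_moving_frame boost_apply sum_subtractf)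
        (simp add: mixture_density_altdef scaleR_sum_left)
    then show ?thesis
      using momentum[of "?G z"]
      by (simp add: frechet_derivative_vel_moving_frame vel_diff phase_stress_moving_frame
          tensor_divergence_boost)
        (simp add: mixture_density_moving_frame boost_apply)
  qed
  have energy': "energy_equation N ?M p" if p: "p \<in> {1..N}" for p
  proof -
    have heat: "(\<lambda>y. alpha ?M p y *\<^sub>R heat_flux ?M p y)
        = boost u0 (\<lambda>y. alpha M p y *\<^sub>R heat_flux M p y)"
      by (simp add: fun_eq_iff moving_frame_simps boost_apply)
    have internal: "frechet_derivative (eint M p) (at z) (mass_flux M p z, phase_mass M p z)
      = (\<Sum>j\<in>UNIV. frechet_derivative (vel M) (at z) (column j (phase_stress M p z), 0) $ j)
        - divergence (\<lambda>y. alpha M p y *\<^sub>R heat_flux M p y) z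
        - (\<Sum>q=1..N. zeta_I M p q z * pres_I M p q z * (pres M p z - pres M q z))
        + (\<Sum>q=1..N. heat_I M p q z)" for z
      using energy[OF p] energy_equation_iff[OF p mass[OF p] rho momentum] by blast
    show ?thesis
      \<comment> \<open>Transport directions are mapped to transport directions and the purely
        spatial directions \<open>(column j _, 0)\<close> are fixed, so every term is its original
        evaluated at \<open>?G z\<close>.\<close>
      unfolding moving.energy_equation_iff[OF p mass'[OF p] rho' momentum'] heat
      using internal p
      by (simp add: frechet_derivative_vel_moving_frame vel_diff divergence_boost
          phase_stress_moving_frame mass_flux_moving_frame phase_mass_moving_frame)
        (simp add: moving_frame_simps frechet_derivative_boost eint_diff boost_apply)
  qed
  have volume': "volume_fraction_equation N ?M p" if p: "p \<in> {1..N}" for p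
  proof -
    have "divergence (vel ?M) z = divergence (vel M) (?G z)" for z
      using divergence_diff[of "boost u0 (vel M)" z "\<lambda>y. u0"]
      by (simp add: moving_frame_simps differentiable_boost vel_diff divergence_boost
          divergence_eq_frechet[of "\<lambda>y. u0"])
    then show ?thesis
      using volume[OF p] p
      \<comment> \<open>Only \<open>alpha\<close>, \<open>pres\<close> and \<open>zeta_I\<close> are
        unfolded, so that \<open>vel ?M\<close> still matches the divergence identity just
        proved.\<close>
      by (simp add: volume_fraction_equation_def volume_flux_moving_frame moving_frame_simps(1,4,9)
          transport_boost alpha_diff volume_flux_diff)
        (simp add: boost_apply)
  qed
  have "momentum_equation N ?M"
    using moving.momentum_equation_iff[OF mass'] momentum' by blast
  then show ?thesis
    by (simp add: six_equation_model_def mass' energy' volume')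
qed

end
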